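(* Let $L$ be a (right) Leibniz algebra over a field of characteristic zero. If every element of $L$ is $L$-split, then $L$ is almost algebraic.
   Context: A (right) Leibniz algebra over a field $F$ is an $F$-vector space with a bilinear product $[\cdot,\cdot]$ satisfying $[x,[y,z]]=[[x,y],z]-[[x,z],y]$ for all $x,y,z$. The Leibniz kernel of $L$ is $I=\mathrm{span}\{x^2: x\in L\}$ with $x^2=[x,x]$; it is an ideal and $L/I$ is a Lie algebra. For $x\in L$, $R_x:L\to L$ is the map $y\mapsto [y,x]$. An element $x\in L$ is called $L$-split if there exist elements $s,n\in L$ such that $R_x=R_s+R_n$ is the (additive Jordan) decomposition of $R_x$ into its semisimple part $R_s$ and nilpotent part $R_n$. Almost algebraic: a linear Lie algebra $\mathfrak g\leq \mathrm{gl}(V)$ is almost algebraic if it contains the nilpotent and semisimple Jordan components of its elements; an abstract Lie algebra $\mathfrak g$ is almost algebraic if $\mathrm{ad}\,\mathfrak g\leq \mathrm{gl}(\mathfrak g)$ is almost algebraic; a Leibniz algebra $L$ is almost algebraic if the Lie algebra $L/I$ is almost algebraic. *)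

theory Defs
  imports "HOL-Algebra.Module" "HOL-Algebra.QuotRing"
begin

text \<open>
  Lie and Leibniz algebras are modelled on the record type \<^type>\<open>module\<close>: the field \<^const>\<open>mult\<close> holds
  the bracket, so \<open>x \<otimes>\<^bsub>L\<^esub> y\<close> stands for \<open>[x, y]\<close>. The field \<^const>\<open>one\<close> plays no role.
  No dimension assumption is made anywhere.
\<close>

locale nonassoc_algebra = field K + module K L for K (structure) and L (structure) +
  assumes bracket_closed:
      "\<lbrakk>x \<in> carrier L; y \<in> carrier L\<rbrakk> \<Longrightarrow> x \<otimes>\<^bsub>L\<^esub> y \<in> carrier L"
    and bracket_add_left:
      "\<lbrakk>x \<in> carrier L; y \<in> carrier L; z \<in> carrier L\<rbrakk>
        \<Longrightarrow> (x \<oplus>\<^bsub>L\<^esub> y) \<otimes>\<^bsub>L\<^esub> z = (x \<otimes>\<^bsub>L\<^esub> z) \<oplus>\<^bsub>L\<^esub> (y \<otimes>\<^bsub>L\<^esub> z)"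
    and bracket_add_right:
      "\<lbrakk>x \<in> carrier L; y \<in> carrier L; z \<in> carrier L\<rbrakk>
        \<Longrightarrow> x \<otimes>\<^bsub>L\<^esub> (y \<oplus>\<^bsub>L\<^esub> z) = (x \<otimes>\<^bsub>L\<^esub> y) \<oplus>\<^bsub>L\<^esub> (x \<otimes>\<^bsub>L\<^esub> z)"
    and bracket_smult_left:
      "\<lbrakk>c \<in> carrier K; x \<in> carrier L; y \<in> carrier L\<rbrakk>
        \<Longrightarrow> (c \<odot>\<^bsub>L\<^esub> x) \<otimes>\<^bsub>L\<^esub> y = c \<odot>\<^bsub>L\<^esub> (x \<otimes>\<^bsub>L\<^esub> y)"
    and bracket_smult_right:
      "\<lbrakk>c \<in> carrier K; x \<in> carrier L; y \<in> carrier L\<rbrakk>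
        \<Longrightarrow> x \<otimes>\<^bsub>L\<^esub> (c \<odot>\<^bsub>L\<^esub> y) = c \<odot>\<^bsub>L\<^esub> (x \<otimes>\<^bsub>L\<^esub> y)"

locale leibniz_algebra = nonassoc_algebra +
  assumes right_leibniz:
    "\<lbrakk>x \<in> carrier L; y \<in> carrier L; z \<in> carrier L\<rbrakk>
      \<Longrightarrow> x \<otimes>\<^bsub>L\<^esub> (y \<otimes>\<^bsub>L\<^esub> z) = ((x \<otimes>\<^bsub>L\<^esub> y) \<otimes>\<^bsub>L\<^esub> z) \<ominus>\<^bsub>L\<^esub> ((x \<otimes>\<^bsub>L\<^esub> z) \<otimes>\<^bsub>L\<^esub> y)"

locale lie_algebra = nonassoc_algebra +
  assumes alternating: "x \<in> carrier L \<Longrightarrow> x \<otimes>\<^bsub>L\<^esub> x = \<zero>\<^bsub>L\<^esub>"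
    and jacobi:
      "\<lbrakk>x \<in> carrier L; y \<in> carrier L; z \<in> carrier L\<rbrakk>
        \<Longrightarrow> (x \<otimes>\<^bsub>L\<^esub> (y \<otimes>\<^bsub>L\<^esub> z)) \<oplus>\<^bsub>L\<^esub> (y \<otimes>\<^bsub>L\<^esub> (z \<otimes>\<^bsub>L\<^esub> x)) \<oplus>\<^bsub>L\<^esub> (z \<otimes>\<^bsub>L\<^esub> (x \<otimes>\<^bsub>L\<^esub> y)) = \<zero>\<^bsub>L\<^esub>"

definition char_zero :: "('k, 'm) ring_scheme \<Rightarrow> bool"
  where "char_zero K \<longleftrightarrow> (\<forall>n::nat. n > 0 \<longrightarrow> [n] \<cdot>\<^bsub>K\<^esub> \<one>\<^bsub>K\<^esub> \<noteq> \<zero>\<^bsub>K\<^esub>)"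

definition submodule_span ::
    "('k, 'm) ring_scheme \<Rightarrow> ('k, 'a, 'n) module_scheme \<Rightarrow> 'a set \<Rightarrow> 'a set"
  where "submodule_span K V A = \<Inter>{W. submodule W K V \<and> A \<subseteq> W}"

definition leibniz_kernel :: "('k, 'm) ring_scheme \<Rightarrow> ('k, 'a, 'n) module_scheme \<Rightarrow> 'a set"
  where "leibniz_kernel K L = submodule_span K L {x \<otimes>\<^bsub>L\<^esub> x | x. x \<in> carrier L}"

text \<open>The quotient of an algebra by an ideal: \<^const>\<open>FactRing\<close> together with scalar multiplication of cosets.\<close>

definition quotient_algebra ::
    "('k, 'a, 'n) module_scheme \<Rightarrow> 'a set \<Rightarrow> ('k, 'a set) module"
  where "quotient_algebra L I =
    \<lparr>carrier = a_rcosets\<^bsub>L\<^esub> I, mult = rcoset_mult L I, one = I +>\<^bsub>L\<^esub> \<one>\<^bsub>L\<^esub>,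
     zero = I, add = set_add L, smult = (\<lambda>c A. \<Union>a\<in>A. I +>\<^bsub>L\<^esub> (c \<odot>\<^bsub>L\<^esub> a))\<rparr>"

text \<open>
  Linear maps are extensional outside the carrier, so that equality of endomorphisms is equality of
  functions. The bracket of \<open>gl V\<close> is the commutator.
\<close>

definition linear_endos ::
    "('k, 'm) ring_scheme \<Rightarrow> ('k, 'a, 'n) module_scheme \<Rightarrow> ('a \<Rightarrow> 'a) set"
  where "linear_endos K V = {f \<in> carrier V \<rightarrow>\<^sub>E carrier V.
    (\<forall>x\<in>carrier V. \<forall>y\<in>carrier V. f (x \<oplus>\<^bsub>V\<^esub> y) = f x \<oplus>\<^bsub>V\<^esub> f y) \<and>
    (\<forall>c\<in>carrier K. \<forall>x\<in>carrier V. f (c \<odot>\<^bsub>V\<^esub> x) = c \<odot>\<^bsub>V\<^esub> f x)}"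

definition gl ::
    "('k, 'm) ring_scheme \<Rightarrow> ('k, 'a, 'n) module_scheme \<Rightarrow> ('k, 'a \<Rightarrow> 'a) module"
  where "gl K V =
    \<lparr>carrier = linear_endos K V,
     mult = (\<lambda>f g. \<lambda>x\<in>carrier V. f (g x) \<ominus>\<^bsub>V\<^esub> g (f x)),
     one = (\<lambda>x\<in>carrier V. x),
     zero = (\<lambda>x\<in>carrier V. \<zero>\<^bsub>V\<^esub>),
     add = (\<lambda>f g. \<lambda>x\<in>carrier V. f x \<oplus>\<^bsub>V\<^esub> g x),
     smult = (\<lambda>c f. \<lambda>x\<in>carrier V. c \<odot>\<^bsub>V\<^esub> f x)\<rparr>"

definition lie_subalgebra ::
    "'a set \<Rightarrow> ('k, 'm) ring_scheme \<Rightarrow> ('k, 'a, 'n) module_scheme \<Rightarrow> bool"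
  where "lie_subalgebra G K L \<longleftrightarrow>
    submodule G K L \<and> (\<forall>x\<in>G. \<forall>y\<in>G. x \<otimes>\<^bsub>L\<^esub> y \<in> G)"

text \<open>
  Over a field that need not be algebraically closed, an operator is semisimple iff every invariant
  subspace has an invariant complement.
\<close>

definition invariant_subspace ::
    "('k, 'm) ring_scheme \<Rightarrow> ('k, 'a, 'n) module_scheme \<Rightarrow> ('a \<Rightarrow> 'a) \<Rightarrow> 'a set \<Rightarrow> bool"
  where "invariant_subspace K V f W \<longleftrightarrow> submodule W K V \<and> f ` W \<subseteq> W"

definition semisimple_endo ::
    "('k, 'm) ring_scheme \<Rightarrow> ('k, 'a, 'n) module_scheme \<Rightarrow> ('a \<Rightarrow> 'a) \<Rightarrow> bool"
  where "semisimple_endo K V f \<longleftrightarrow>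
    f \<in> linear_endos K V \<and>
    (\<forall>W. invariant_subspace K V f W \<longrightarrow>
      (\<exists>U. invariant_subspace K V f U \<and> W <+>\<^bsub>V\<^esub> U = carrier V \<and> W \<inter> U = {\<zero>\<^bsub>V\<^esub>}))"

definition nilpotent_endo ::
    "('k, 'm) ring_scheme \<Rightarrow> ('k, 'a, 'n) module_scheme \<Rightarrow> ('a \<Rightarrow> 'a) \<Rightarrow> bool"
  where "nilpotent_endo K V f \<longleftrightarrow>
    f \<in> linear_endos K V \<and> (\<exists>n::nat. \<forall>x\<in>carrier V. (f ^^ n) x = \<zero>\<^bsub>V\<^esub>)"

definition jordan_decomposition ::
    "('k, 'm) ring_scheme \<Rightarrow> ('k, 'a, 'n) module_scheme
      \<Rightarrow> ('a \<Rightarrow> 'a) \<Rightarrow> ('a \<Rightarrow> 'a) \<Rightarrow> ('a \<Rightarrow> 'a) \<Rightarrow> bool"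
  where "jordan_decomposition K V f S N \<longleftrightarrow>
    semisimple_endo K V S \<and> nilpotent_endo K V N \<and>
    (\<forall>x\<in>carrier V. S (N x) = N (S x)) \<and> f = S \<oplus>\<^bsub>gl K V\<^esub> N"

definition right_mult :: "('k, 'a, 'n) module_scheme \<Rightarrow> 'a \<Rightarrow> 'a \<Rightarrow> 'a"
  where "right_mult L x = (\<lambda>y\<in>carrier L. y \<otimes>\<^bsub>L\<^esub> x)"

definition ad :: "('k, 'a, 'n) module_scheme \<Rightarrow> 'a \<Rightarrow> 'a \<Rightarrow> 'a"
  where "ad L x = (\<lambda>y\<in>carrier L. x \<otimes>\<^bsub>L\<^esub> y)"

definition L_split :: "('k, 'm) ring_scheme \<Rightarrow> ('k, 'a, 'n) module_scheme \<Rightarrow> 'a \<Rightarrow> bool"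
  where "L_split K L x \<longleftrightarrow>
    (\<exists>s\<in>carrier L. \<exists>n\<in>carrier L.
      jordan_decomposition K L (right_mult L x) (right_mult L s) (right_mult L n))"

definition almost_algebraic_linear ::
    "('k, 'm) ring_scheme \<Rightarrow> ('k, 'a, 'n) module_scheme \<Rightarrow> ('a \<Rightarrow> 'a) set \<Rightarrow> bool"
  where "almost_algebraic_linear K V G \<longleftrightarrow>
    lie_subalgebra G K (gl K V) \<and>
    (\<forall>f\<in>G. \<exists>S\<in>G. \<exists>N\<in>G. jordan_decomposition K V f S N)"

definition almost_algebraic_lie ::
    "('k, 'm) ring_scheme \<Rightarrow> ('k, 'a, 'n) module_scheme \<Rightarrow> bool"
  where "almost_algebraic_lie K L \<longleftrightarrow>
    lie_algebra K L \<and> almost_algebraic_linear K L (ad L ` carrier L)"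

definition almost_algebraic_leibniz ::
    "('k, 'm) ring_scheme \<Rightarrow> ('k, 'a, 'n) module_scheme \<Rightarrow> bool"
  where "almost_algebraic_leibniz K L \<longleftrightarrow>
    leibniz_algebra K L \<and> almost_algebraic_lie K (quotient_algebra L (leibniz_kernel K L))"

end

theory Submission
  imports Defs
begin

text \<open>
  A Jordan decomposition on \<open>V\<close> descends along any surjective linear map \<open>h : V \<rightarrow> W\<close> that intertwines the
  operators. Only semisimplicity needs thought: if \<open>A\<close> is an invariant subspace of \<open>W\<close> and \<open>U\<close> is an
  invariant complement of \<open>h\<^sup>-\<^sup>1(A)\<close>, then \<open>h(U)\<close> is an invariant complement of \<open>A\<close>, because
  \<open>h\<^sup>-\<^sup>1(A)\<close> contains the kernel of \<open>h\<close>. In the Lie algebra \<open>L/I\<close> one has \<open>ad x = R\<^sub>-\<^sub>x\<close>, so splitting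
  \<open>R\<^sub>-\<^sub>x\<close> in \<open>L\<close> splits \<open>ad (x + I)\<close>. No finiteness of dimension is involved.
\<close>

section \<open>Linear maps and Jordan decompositions\<close>

text \<open>Values outside the carrier are left free, so that the coset map \<open>(+>) I\<close>
  qualifies; \<open>linear_endos_iff\<close> adds extensionality back for endomorphisms.\<close>

definition linear_map ::
    "('k, 'm) ring_scheme \<Rightarrow> ('k, 'a, 'n) module_scheme \<Rightarrow> ('k, 'b, 'p) module_scheme \<Rightarrow> ('a \<Rightarrow> 'b) set"
  where "linear_map K V W = {h \<in> carrier V \<rightarrow> carrier W.
    (\<forall>x\<in>carrier V. \<forall>y\<in>carrier V. h (x \<oplus>\<^bsub>V\<^esub> y) = h x \<oplus>\<^bsub>W\<^esub> h y) \<and>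
    (\<forall>c\<in>carrier K. \<forall>x\<in>carrier V. h (c \<odot>\<^bsub>V\<^esub> x) = c \<odot>\<^bsub>W\<^esub> h x)}"

lemma linear_endos_iff:
  "f \<in> linear_endos K V \<longleftrightarrow> f \<in> linear_map K V V \<and> f \<in> extensional (carrier V)"
  by (auto simp: linear_endos_def linear_map_def PiE_def)

lemma linear_map_closed: "h \<in> linear_map K V W \<Longrightarrow> x \<in> carrier V \<Longrightarrow> h x \<in> carrier W"
  by (auto simp: linear_map_def)

lemma linear_map_add:
  "h \<in> linear_map K V W \<Longrightarrow> x \<in> carrier V \<Longrightarrow> y \<in> carrier V \<Longrightarrow> h (x \<oplus>\<^bsub>V\<^esub> y) = h x \<oplus>\<^bsub>W\<^esub> h y"
  by (auto simp: linear_map_def)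

lemma linear_map_smult:
  "h \<in> linear_map K V W \<Longrightarrow> c \<in> carrier K \<Longrightarrow> x \<in> carrier V \<Longrightarrow> h (c \<odot>\<^bsub>V\<^esub> x) = c \<odot>\<^bsub>W\<^esub> h x"
  by (auto simp: linear_map_def)

section \<open>Transport of operators along a surjective linear map\<close>

locale module_epi = V: module K V + W: module K W
  for K :: "('k, 'm) ring_scheme"
    and V :: "('k, 'a, 'n) module_scheme" and W :: "('k, 'b, 'p) module_scheme" +
  fixes h
  assumes linear: "h \<in> linear_map K V W" and onto: "h ` carrier V = carrier W"
begin

lemmas map_closed [simp] = linear_map_closed[OF linear]
lemmas map_add = linear_map_add[OF linear]
lemmas map_smult = linear_map_smult[OF linear]

lemma map_zero: "h \<zero>\<^bsub>V\<^esub> = \<zero>\<^bsub>W\<^esub>"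
  using map_smult[of "\<zero>\<^bsub>K\<^esub>" "\<zero>\<^bsub>V\<^esub>"] by simp

lemma map_minus: "x \<in> carrier V \<Longrightarrow> h (\<ominus>\<^bsub>V\<^esub> x) = \<ominus>\<^bsub>W\<^esub> h x"
  using map_smult[of "\<ominus>\<^bsub>K\<^esub> \<one>\<^bsub>K\<^esub>" x] by (simp add: V.smult_l_minus W.smult_l_minus)

text \<open>Surjectivity in elimination form: the intertwining relations only speak of elements
  \<open>h x\<close>, and this makes them cover all of \<open>W\<close>.\<close>

lemma carrier_cases:
  assumes "y \<in> carrier W" obtains x where "x \<in> carrier V" "y = h x"
  using assms onto by blast

lemma submodule_vimage:
  assumes "submodule A K W"
  shows "submodule {x \<in> carrier V. h x \<in> A} K V"
  using W.submoduleE[OF assms] subgroup.one_closed[OF submodule.axioms(1)[OF assms]]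
  by (intro V.submoduleI) (auto simp: map_zero map_minus map_add map_smult)

lemma submodule_image:
  assumes "submodule A K V"
  shows "submodule (h ` A) K W"
proof -
  note A = V.submoduleE[OF assms]
  have zero: "\<zero>\<^bsub>V\<^esub> \<in> A"
    using subgroup.one_closed[OF submodule.axioms(1)[OF assms]] by simp
  show ?thesis
  proof (rule W.submoduleI)
    show "h ` A \<subseteq> carrier W" using A(1) by auto
    show "\<zero>\<^bsub>W\<^esub> \<in> h ` A" using zero map_zero by (metis image_eqI)
    show "\<ominus>\<^bsub>W\<^esub> a \<in> h ` A" if "a \<in> h ` A" for a
    proof -
      from that obtain a' where "a' \<in> A" "a = h a'" by blast
      then show ?thesis
        using A(1,3) map_minus[of a'] by (metis imageI subsetD)
    qed
    show "a \<oplus>\<^bsub>W\<^esub> b \<in> h ` A" if ab: "a \<in> h ` A" "b \<in> h ` A" for a b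
    proof -
      from ab obtain a' b' where "a' \<in> A" "b' \<in> A" "a = h a'" "b = h b'" by blast
      then show ?thesis
        using A(1,5) map_add[of a' b'] by (metis imageI subsetD)
    qed
    show "c \<odot>\<^bsub>W\<^esub> a \<in> h ` A" if "c \<in> carrier K" "a \<in> h ` A" for c a
    proof -
      from that obtain a' where "a' \<in> A" "a = h a'" by blast
      then show ?thesis
        using that A(1,4) map_smult[of c a'] by (metis imageI subsetD)
    qed
  qed
qed

lemma semisimple_endo_image:
  assumes f: "semisimple_endo K V f" and g: "g \<in> linear_endos K W"
    and fg: "\<And>x. x \<in> carrier V \<Longrightarrow> g (h x) = h (f x)"
  shows "semisimple_endo K W g"
  unfolding semisimple_endo_def
proof (intro conjI allI impI g)
  fix A assume A: "invariant_subspace K W g A"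
  then have subA: "submodule A K W" and gA: "g ` A \<subseteq> A" by (auto simp: invariant_subspace_def)
  \<comment> \<open>The full preimage of \<open>A\<close>; it is \<open>f\<close>-invariant because
    \<open>h (f x) = g (h x)\<close> stays in \<open>A\<close>.\<close>
  let ?A = "{x \<in> carrier V. h x \<in> A}"
  have f_closed: "f x \<in> carrier V" if "x \<in> carrier V" for x
    using f that by (auto simp: semisimple_endo_def linear_endos_iff intro: linear_map_closed)
  have "invariant_subspace K V f ?A"
    using submodule_vimage[OF subA] gA fg f_closed
    by (force simp: invariant_subspace_def)
  then obtain U where U: "invariant_subspace K V f U" "?A <+>\<^bsub>V\<^esub> U = carrier V" "?A \<inter> U = {\<zero>\<^bsub>V\<^esub>}"
    using f unfolding semisimple_endo_def by blast
  have subU: "submodule U K V" and fU: "f ` U \<subseteq> U"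
    using U(1) by (auto simp: invariant_subspace_def)
  have Uc: "U \<subseteq> carrier V" using V.submoduleE(1)[OF subU] .
  have Ac: "A \<subseteq> carrier W" using W.submoduleE(1)[OF subA] .
  have sub_hU: "submodule (h ` U) K W" by (rule submodule_image[OF subU])
  show "\<exists>U. invariant_subspace K W g U \<and> A <+>\<^bsub>W\<^esub> U = carrier W \<and> A \<inter> U = {\<zero>\<^bsub>W\<^esub>}"
  proof (intro exI conjI)
    have "g (h u) \<in> h ` U" if "u \<in> U" for u
      using that fU Uc fg by auto
    then show "invariant_subspace K W g (h ` U)"
      using sub_hU by (auto simp: invariant_subspace_def)
    show "A <+>\<^bsub>W\<^esub> h ` U = carrier W"
    proof
      show "A <+>\<^bsub>W\<^esub> h ` U \<subseteq> carrier W"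
        using Ac Uc by (intro W.set_add_closed) auto
      show "carrier W \<subseteq> A <+>\<^bsub>W\<^esub> h ` U"
      proof
        fix y assume "y \<in> carrier W"
        then obtain x where x: "x \<in> carrier V" "y = h x" by (rule carrier_cases)
        then obtain a u where au: "a \<in> ?A" "u \<in> U" "x = a \<oplus>\<^bsub>V\<^esub> u"
          using U(2) by (force simp: set_add_def')
        then have "y = h a \<oplus>\<^bsub>W\<^esub> h u" using x Uc by (auto simp: map_add)
        then show "y \<in> A <+>\<^bsub>W\<^esub> h ` U" using au by (force simp: set_add_def')
      qed
    qed
    \<comment> \<open>Since \<open>?A\<close> is the full preimage, a \<open>u\<close> in
      \<open>U\<close> with \<open>h u\<close> in \<open>A\<close> already lies in
      \<open>?A\<close>, where the complement \<open>U\<close> only meets it in zero.\<close>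
    have "h u = \<zero>\<^bsub>W\<^esub>" if "u \<in> U" "h u \<in> A" for u
    proof -
      have "u \<in> ?A \<inter> U" using that Uc by auto
      then have "u = \<zero>\<^bsub>V\<^esub>" unfolding U(3) by simp
      then show ?thesis by (simp add: map_zero)
    qed
    moreover have "\<zero>\<^bsub>W\<^esub> \<in> A" "\<zero>\<^bsub>W\<^esub> \<in> h ` U"
      using subgroup.one_closed[OF submodule.axioms(1)[OF subA]]
        subgroup.one_closed[OF submodule.axioms(1)[OF sub_hU]] by simp_all
    ultimately show "A \<inter> h ` U = {\<zero>\<^bsub>W\<^esub>}" by auto
  qed
qed

text \<open>The exponent that kills \<open>V\<close> also kills \<open>W\<close>, because
  \<open>h\<close> intertwines the powers of \<open>f\<close> and \<open>g\<close> as well.\<close>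

lemma nilpotent_endo_image:
  assumes f: "nilpotent_endo K V f" and g: "g \<in> linear_endos K W"
    and fg: "\<And>x. x \<in> carrier V \<Longrightarrow> g (h x) = h (f x)"
  shows "nilpotent_endo K W g"
proof -
  obtain n where n: "\<And>x. x \<in> carrier V \<Longrightarrow> (f ^^ n) x = \<zero>\<^bsub>V\<^esub>"
    using f by (auto simp: nilpotent_endo_def)
  have "f x \<in> carrier V" if "x \<in> carrier V" for x
    using f that by (auto simp: nilpotent_endo_def linear_endos_iff intro: linear_map_closed)
  \<comment> \<open>Membership in the carrier is carried through the induction, since
    \<open>fg\<close> can only be applied there.\<close>
  then have "(f ^^ m) x \<in> carrier V \<and> (g ^^ m) (h x) = h ((f ^^ m) x)" if "x \<in> carrier V" for m x
    using that fg by (induction m) auto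
  then have "(g ^^ n) (h x) = \<zero>\<^bsub>W\<^esub>" if "x \<in> carrier V" for x
    using that n map_zero by simp
  then have "\<forall>y\<in>carrier W. (g ^^ n) y = \<zero>\<^bsub>W\<^esub>"
    by (metis carrier_cases)
  then show ?thesis using g by (auto simp: nilpotent_endo_def)
qed

lemma jordan_decomposition_image:
  assumes J: "jordan_decomposition K V f S N"
    and f': "f' \<in> linear_endos K W" "\<And>x. x \<in> carrier V \<Longrightarrow> f' (h x) = h (f x)"
    and S': "S' \<in> linear_endos K W" "\<And>x. x \<in> carrier V \<Longrightarrow> S' (h x) = h (S x)"
    and N': "N' \<in> linear_endos K W" "\<And>x. x \<in> carrier V \<Longrightarrow> N' (h x) = h (N x)"
  shows "jordan_decomposition K W f' S' N'"
  unfolding jordan_decomposition_def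
proof (intro conjI ballI)
  have SN: "S x \<in> carrier V" "N x \<in> carrier V" if "x \<in> carrier V" for x
    using J that by (auto simp: jordan_decomposition_def semisimple_endo_def nilpotent_endo_def
        linear_endos_iff intro: linear_map_closed)
  show "semisimple_endo K W S'"
    using J S' by (auto simp: jordan_decomposition_def intro: semisimple_endo_image)
  show "nilpotent_endo K W N'"
    using J N' by (auto simp: jordan_decomposition_def intro: nilpotent_endo_image)
  show "S' (N' y) = N' (S' y)" if "y \<in> carrier W" for y
    using that
  proof (rule carrier_cases)
    fix x assume "x \<in> carrier V" "y = h x"
    then show ?thesis using J S'(2) N'(2) SN by (simp add: jordan_decomposition_def)
  qed
  show "f' = S' \<oplus>\<^bsub>gl K W\<^esub> N'"
  proof
    fix y
    show "f' y = (S' \<oplus>\<^bsub>gl K W\<^esub> N') y"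
    proof (cases "y \<in> carrier W")
      case True
      then obtain x where x: "x \<in> carrier V" "y = h x" by (rule carrier_cases)
      have "f x = S x \<oplus>\<^bsub>V\<^esub> N x"
        using J x by (simp add: jordan_decomposition_def gl_def)
      then show ?thesis using x f'(2) S'(2) N'(2) SN by (simp add: gl_def map_add)
    next
      \<comment> \<open>Equality of operators is equality of total functions; off the carrier both
        sides are \<open>undefined\<close>.\<close>
      case False
      then show ?thesis using f'(1) by (auto simp: gl_def linear_endos_iff extensional_def)
    qed
  qed
qed

end

text \<open>Lets the submodule rules be applied to the image of \<open>ad\<close> in
  \<open>gl\<close>. Operations are pointwise and operators are extensional, so each axiom reduces
  to the same axiom in \<open>M\<close>.\<close>

lemma (in module) gl_module: "module R (gl R M)"
proof -
  have carr: "carrier (gl R M) = linear_endos R M"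
    by (simp add: gl_def)
  have ext: "f = g" if "f \<in> linear_endos R M" "g \<in> linear_endos R M"
    "\<And>x. x \<in> carrier M \<Longrightarrow> f x = g x" for f g
    using that by (auto simp: linear_endos_iff intro: extensionalityI)
  have endo: "f x \<in> carrier M" if "f \<in> linear_endos R M" "x \<in> carrier M" for f x
    using that by (auto simp: linear_endos_iff intro: linear_map_closed)
  have app: "(f \<oplus>\<^bsub>gl R M\<^esub> g) x = f x \<oplus>\<^bsub>M\<^esub> g x" "(c \<odot>\<^bsub>gl R M\<^esub> f) x = c \<odot>\<^bsub>M\<^esub> f x"
    "\<zero>\<^bsub>gl R M\<^esub> x = \<zero>\<^bsub>M\<^esub>" if "x \<in> carrier M" for f g c x
    using that by (simp_all add: gl_def)
  have add: "f \<oplus>\<^bsub>gl R M\<^esub> g \<in> linear_endos R M"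
    if "f \<in> linear_endos R M" "g \<in> linear_endos R M" for f g
    using that endo[OF that(1)] endo[OF that(2)]
    by (auto simp: gl_def linear_endos_def smult_r_distr M.a_ac)
  have smult: "c \<odot>\<^bsub>gl R M\<^esub> f \<in> linear_endos R M"
    if "c \<in> carrier R" "f \<in> linear_endos R M" for f c
    using that endo[OF that(2)]
    by (auto simp: gl_def linear_endos_def smult_r_distr smult_assoc1[symmetric] R.m_comm)
  have zero: "\<zero>\<^bsub>gl R M\<^esub> \<in> linear_endos R M"
    by (auto simp: gl_def linear_endos_def)
  \<comment> \<open>The additive inverse is taken as the scalar multiple by
    \<open>\<ominus> \<one>\<close>, whose linearity is already known from
    \<open>smult\<close>.\<close>
  have neg: "\<exists>g\<in>linear_endos R M. g \<oplus>\<^bsub>gl R M\<^esub> f = \<zero>\<^bsub>gl R M\<^esub>" if f: "f \<in> linear_endos R M" for f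
  proof
    show minus: "(\<ominus> \<one>) \<odot>\<^bsub>gl R M\<^esub> f \<in> linear_endos R M" using f by (intro smult) auto
    show "(\<ominus> \<one>) \<odot>\<^bsub>gl R M\<^esub> f \<oplus>\<^bsub>gl R M\<^esub> f = \<zero>\<^bsub>gl R M\<^esub>"
      using endo[OF f] by (intro ext add minus f zero) (simp add: app smult_l_minus M.l_neg)
  qed
  have "abelian_group (gl R M)"
    by (rule abelian_groupI; (unfold carr)?)
      (use add zero neg in \<open>auto intro!: ext simp: app endo M.a_ac\<close>)
  then show ?thesis
    by (intro moduleI R.is_cring; (unfold carr)?)
      (auto intro!: ext add smult simp: app endo smult_l_distr smult_r_distr smult_assoc1)
qed

section \<open>Algebras and their quotients\<close>

context nonassoc_algebra
begin

lemma bracket_zero_left: "x \<in> carrier L \<Longrightarrow> \<zero>\<^bsub>L\<^esub> \<otimes>\<^bsub>L\<^esub> x = \<zero>\<^bsub>L\<^esub>"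
  using bracket_smult_left[of "\<zero>\<^bsub>K\<^esub>" "\<zero>\<^bsub>L\<^esub>" x] by (simp add: bracket_closed)

lemma bracket_zero_right: "x \<in> carrier L \<Longrightarrow> x \<otimes>\<^bsub>L\<^esub> \<zero>\<^bsub>L\<^esub> = \<zero>\<^bsub>L\<^esub>"
  using bracket_smult_right[of "\<zero>\<^bsub>K\<^esub>" x "\<zero>\<^bsub>L\<^esub>"] by (simp add: bracket_closed)

lemma bracket_minus_left:
  "\<lbrakk>x \<in> carrier L; y \<in> carrier L\<rbrakk> \<Longrightarrow> (\<ominus>\<^bsub>L\<^esub> x) \<otimes>\<^bsub>L\<^esub> y = \<ominus>\<^bsub>L\<^esub> (x \<otimes>\<^bsub>L\<^esub> y)"
  using bracket_smult_left[of "\<ominus>\<^bsub>K\<^esub> \<one>\<^bsub>K\<^esub>" x y] by (simp add: smult_l_minus bracket_closed)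

lemma bracket_minus_right:
  "\<lbrakk>x \<in> carrier L; y \<in> carrier L\<rbrakk> \<Longrightarrow> x \<otimes>\<^bsub>L\<^esub> (\<ominus>\<^bsub>L\<^esub> y) = \<ominus>\<^bsub>L\<^esub> (x \<otimes>\<^bsub>L\<^esub> y)"
  using bracket_smult_right[of "\<ominus>\<^bsub>K\<^esub> \<one>\<^bsub>K\<^esub>" x y] by (simp add: smult_l_minus bracket_closed)

lemma right_mult_linear: "x \<in> carrier L \<Longrightarrow> right_mult L x \<in> linear_endos K L"
  by (auto simp: right_mult_def linear_endos_def bracket_closed bracket_add_left bracket_smult_left)

lemma ad_linear: "x \<in> carrier L \<Longrightarrow> ad L x \<in> linear_endos K L"
  by (auto simp: ad_def linear_endos_def bracket_closed bracket_add_right bracket_smult_right)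

text \<open>Polarisation: expand the square of \<open>x + y\<close>. The vanishing of squares is a
  premise here, so that the result serves both Lie algebras and Leibniz algebras not yet known to be
  Lie.\<close>

lemma alternating_imp_anticommute:
  assumes sq: "\<And>x. x \<in> carrier L \<Longrightarrow> x \<otimes>\<^bsub>L\<^esub> x = \<zero>\<^bsub>L\<^esub>"
    and xy: "x \<in> carrier L" "y \<in> carrier L"
  shows "x \<otimes>\<^bsub>L\<^esub> y = \<ominus>\<^bsub>L\<^esub> (y \<otimes>\<^bsub>L\<^esub> x)"
proof -
  have "(x \<oplus>\<^bsub>L\<^esub> y) \<otimes>\<^bsub>L\<^esub> (x \<oplus>\<^bsub>L\<^esub> y) = \<zero>\<^bsub>L\<^esub>" using xy by (intro sq) simp
  then have "y \<otimes>\<^bsub>L\<^esub> x \<oplus>\<^bsub>L\<^esub> x \<otimes>\<^bsub>L\<^esub> y = \<zero>\<^bsub>L\<^esub>"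
    using xy by (simp add: bracket_add_left bracket_add_right bracket_closed sq[OF xy(1)] sq[OF xy(2)])
  then have "x \<otimes>\<^bsub>L\<^esub> y \<oplus>\<^bsub>L\<^esub> y \<otimes>\<^bsub>L\<^esub> x = \<zero>\<^bsub>L\<^esub>"
    using xy by (simp add: M.a_comm bracket_closed)
  then show ?thesis using M.minus_equality[of "x \<otimes>\<^bsub>L\<^esub> y" "y \<otimes>\<^bsub>L\<^esub> x"] xy
    by (simp add: bracket_closed)
qed

end

section \<open>Two-sided ideals and coset arithmetic\<close>

locale nonassoc_ideal = nonassoc_algebra +
  fixes I
  assumes ideal_submodule: "submodule I K L"
    and ideal_left: "\<lbrakk>x \<in> carrier L; a \<in> I\<rbrakk> \<Longrightarrow> x \<otimes>\<^bsub>L\<^esub> a \<in> I"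
    and ideal_right: "\<lbrakk>a \<in> I; x \<in> carrier L\<rbrakk> \<Longrightarrow> a \<otimes>\<^bsub>L\<^esub> x \<in> I"
begin

sublocale abelian_subgroup I L
  using submodule.axioms(1)[OF ideal_submodule]
  by (intro abelian_subgroupI3 additive_subgroup.intro M.abelian_group_axioms)

abbreviation Q where "Q \<equiv> quotient_algebra L I"

lemma coset_eqI:
  assumes "x \<in> carrier L" "a \<in> I"
  shows "I +>\<^bsub>L\<^esub> (a \<oplus>\<^bsub>L\<^esub> x) = I +>\<^bsub>L\<^esub> x"
  using a_repr_independence'[of "a \<oplus>\<^bsub>L\<^esub> x" x] assms by (auto simp: a_r_coset_def')

text \<open>\<open>rcoset_mult\<close> is a union over all pairs of representatives, so these must
  all yield one coset: \<open>[a + x, b + y]\<close> differs from \<open>[x, y]\<close> by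
  \<open>[a, b] + [a, y] + [x, b]\<close>, which lies in \<open>I\<close>.\<close>

lemma coset_mult:
  assumes x: "x \<in> carrier L" and y: "y \<in> carrier L"
  shows "rcoset_mult L I (I +>\<^bsub>L\<^esub> x) (I +>\<^bsub>L\<^esub> y) = I +>\<^bsub>L\<^esub> (x \<otimes>\<^bsub>L\<^esub> y)"
proof -
  have *: "I +>\<^bsub>L\<^esub> (u \<otimes>\<^bsub>L\<^esub> v) = I +>\<^bsub>L\<^esub> (x \<otimes>\<^bsub>L\<^esub> y)" if "u \<in> I +>\<^bsub>L\<^esub> x" "v \<in> I +>\<^bsub>L\<^esub> y" for u v
  proof -
    from that obtain a b where ab: "a \<in> I" "b \<in> I" "u = a \<oplus>\<^bsub>L\<^esub> x" "v = b \<oplus>\<^bsub>L\<^esub> y"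
      by (auto simp: a_r_coset_def')
    have abc: "a \<in> carrier L" "b \<in> carrier L" using ab by auto
    have "u \<otimes>\<^bsub>L\<^esub> v = (a \<otimes>\<^bsub>L\<^esub> b \<oplus>\<^bsub>L\<^esub> a \<otimes>\<^bsub>L\<^esub> y \<oplus>\<^bsub>L\<^esub> x \<otimes>\<^bsub>L\<^esub> b) \<oplus>\<^bsub>L\<^esub> x \<otimes>\<^bsub>L\<^esub> y"
      using ab abc x y
      by (simp add: bracket_add_left bracket_add_right bracket_closed M.a_ac)
    moreover have "a \<otimes>\<^bsub>L\<^esub> b \<oplus>\<^bsub>L\<^esub> a \<otimes>\<^bsub>L\<^esub> y \<oplus>\<^bsub>L\<^esub> x \<otimes>\<^bsub>L\<^esub> b \<in> I"
      using ab abc x y by (intro a_closed ideal_left ideal_right)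
    ultimately show ?thesis using x y by (simp add: coset_eqI bracket_closed)
  qed
  \<comment> \<open>Both index sets are nonempty, so the union collapses to the common
    coset.\<close>
  have "x \<in> I +>\<^bsub>L\<^esub> x" "y \<in> I +>\<^bsub>L\<^esub> y" using x y by (auto intro: a_rcos_self)
  then show ?thesis using * unfolding rcoset_mult_def by blast
qed

lemma coset_smult:
  assumes c: "c \<in> carrier K" and x: "x \<in> carrier L"
  shows "(\<Union>u\<in>I +>\<^bsub>L\<^esub> x. I +>\<^bsub>L\<^esub> (c \<odot>\<^bsub>L\<^esub> u)) = I +>\<^bsub>L\<^esub> (c \<odot>\<^bsub>L\<^esub> x)"
proof -
  have "I +>\<^bsub>L\<^esub> (c \<odot>\<^bsub>L\<^esub> u) = I +>\<^bsub>L\<^esub> (c \<odot>\<^bsub>L\<^esub> x)" if "u \<in> I +>\<^bsub>L\<^esub> x" for u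
  proof -
    from that obtain a where a: "a \<in> I" "u = a \<oplus>\<^bsub>L\<^esub> x"
      by (auto simp: a_r_coset_def')
    have "c \<odot>\<^bsub>L\<^esub> a \<in> I" using submodule.smult_closed[OF ideal_submodule c a(1)] .
    then show ?thesis using a c x by (simp add: smult_r_distr coset_eqI)
  qed
  then show ?thesis using a_rcos_self[OF x] by blast
qed

lemma quotient_carrier: "carrier Q = (+>\<^bsub>L\<^esub>) I ` carrier L"
  by (auto simp: quotient_algebra_def A_RCOSETS_def')

lemma quotient_add:
  "x \<in> carrier L \<Longrightarrow> y \<in> carrier L \<Longrightarrow>
    (I +>\<^bsub>L\<^esub> x) \<oplus>\<^bsub>Q\<^esub> (I +>\<^bsub>L\<^esub> y) = I +>\<^bsub>L\<^esub> (x \<oplus>\<^bsub>L\<^esub> y)"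
  by (simp add: quotient_algebra_def a_rcos_sum)

lemma quotient_mult:
  "x \<in> carrier L \<Longrightarrow> y \<in> carrier L \<Longrightarrow>
    (I +>\<^bsub>L\<^esub> x) \<otimes>\<^bsub>Q\<^esub> (I +>\<^bsub>L\<^esub> y) = I +>\<^bsub>L\<^esub> (x \<otimes>\<^bsub>L\<^esub> y)"
  by (simp add: quotient_algebra_def coset_mult)

lemma quotient_smult:
  "c \<in> carrier K \<Longrightarrow> x \<in> carrier L \<Longrightarrow> c \<odot>\<^bsub>Q\<^esub> (I +>\<^bsub>L\<^esub> x) = I +>\<^bsub>L\<^esub> (c \<odot>\<^bsub>L\<^esub> x)"
  by (simp add: quotient_algebra_def coset_smult)

lemma quotient_zero: "\<zero>\<^bsub>Q\<^esub> = I +>\<^bsub>L\<^esub> \<zero>\<^bsub>L\<^esub>"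
  by (simp add: quotient_algebra_def a_rcos_const)

text \<open>With zero also in coset form, these turn an axiom of \<open>Q\<close> into the coset
  image of the same axiom of \<open>L\<close>.\<close>

lemmas quotient_simps = quotient_carrier quotient_add quotient_mult quotient_smult quotient_zero

lemma quotient_algebra_is_algebra: "nonassoc_algebra K Q"
proof -
  have "abelian_group Q"
  proof (rule abelian_groupI)
    fix X assume "X \<in> carrier Q"
    then obtain x where x: "x \<in> carrier L" "X = I +>\<^bsub>L\<^esub> x" by (auto simp: quotient_carrier)
    then show "\<exists>Y\<in>carrier Q. Y \<oplus>\<^bsub>Q\<^esub> X = \<zero>\<^bsub>Q\<^esub>"
      by (intro bexI[of _ "I +>\<^bsub>L\<^esub> (\<ominus>\<^bsub>L\<^esub> x)"]) (simp_all add: quotient_simps M.l_neg)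
  qed (auto simp: quotient_simps M.a_ac)
  then have "module K Q"
    by (intro moduleI is_cring)
      (auto simp: quotient_simps smult_l_distr smult_r_distr smult_assoc1)
  then show ?thesis
    by (intro nonassoc_algebra.intro nonassoc_algebra_axioms.intro field_axioms)
      (auto simp: quotient_simps bracket_closed bracket_add_left bracket_add_right
        bracket_smult_left bracket_smult_right)
qed

lemma coset_module_epi: "module_epi K L Q ((+>\<^bsub>L\<^esub>) I)"
proof -
  interpret Q: nonassoc_algebra K Q by (rule quotient_algebra_is_algebra)
  show ?thesis
    by unfold_locales (auto simp: linear_map_def quotient_simps)
qed

end

section \<open>Lie and Leibniz algebras\<close>

text \<open>Under anticommutativity the last two Jacobi terms become \<open>[[x, z], y]\<close> and
  \<open>-[[x, y], z]\<close>, which cancel \<open>[x, [y, z]]\<close> as expanded by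
  \<open>right_leibniz\<close>.\<close>

lemma (in leibniz_algebra) alternating_imp_lie:
  assumes sq: "\<And>x. x \<in> carrier L \<Longrightarrow> x \<otimes>\<^bsub>L\<^esub> x = \<zero>\<^bsub>L\<^esub>"
  shows "lie_algebra K L"
proof (intro lie_algebra.intro lie_algebra_axioms.intro nonassoc_algebra_axioms sq)
  note anti = alternating_imp_anticommute[OF sq]
  fix x y z assume xyz: "x \<in> carrier L" "y \<in> carrier L" "z \<in> carrier L"
  have "y \<otimes>\<^bsub>L\<^esub> (z \<otimes>\<^bsub>L\<^esub> x) = (x \<otimes>\<^bsub>L\<^esub> z) \<otimes>\<^bsub>L\<^esub> y"
    using xyz anti[of y "z \<otimes>\<^bsub>L\<^esub> x"] anti[of z x]
    by (simp add: bracket_closed bracket_minus_left)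
  moreover have "z \<otimes>\<^bsub>L\<^esub> (x \<otimes>\<^bsub>L\<^esub> y) = \<ominus>\<^bsub>L\<^esub> ((x \<otimes>\<^bsub>L\<^esub> y) \<otimes>\<^bsub>L\<^esub> z)"
    using xyz anti[of z "x \<otimes>\<^bsub>L\<^esub> y"] by (simp add: bracket_closed)
  ultimately show "x \<otimes>\<^bsub>L\<^esub> (y \<otimes>\<^bsub>L\<^esub> z) \<oplus>\<^bsub>L\<^esub> y \<otimes>\<^bsub>L\<^esub> (z \<otimes>\<^bsub>L\<^esub> x) \<oplus>\<^bsub>L\<^esub> z \<otimes>\<^bsub>L\<^esub> (x \<otimes>\<^bsub>L\<^esub> y) = \<zero>\<^bsub>L\<^esub>"
    using xyz
    by (simp add: right_leibniz bracket_closed M.minus_eq M.a_assoc M.l_neg M.r_neg)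
qed

section \<open>The adjoint representation\<close>

context lie_algebra
begin

lemmas anticommute = alternating_imp_anticommute[OF alternating]

lemma ad_conv_right_mult: "x \<in> carrier L \<Longrightarrow> ad L x = right_mult L (\<ominus>\<^bsub>L\<^esub> x)"
  using anticommute[of x] by (auto simp: ad_def right_mult_def bracket_minus_right)

text \<open>The Jacobi identity read as compatibility of \<open>ad\<close> with commutators; it
  closes the image of \<open>ad\<close> under the bracket of \<open>gl K L\<close>.\<close>

lemma ad_bracket:
  assumes "x \<in> carrier L" "y \<in> carrier L"
  shows "ad L x \<otimes>\<^bsub>gl K L\<^esub> ad L y = ad L (x \<otimes>\<^bsub>L\<^esub> y)"
proof -
  have "x \<otimes>\<^bsub>L\<^esub> (y \<otimes>\<^bsub>L\<^esub> z) \<ominus>\<^bsub>L\<^esub> y \<otimes>\<^bsub>L\<^esub> (x \<otimes>\<^bsub>L\<^esub> z) = (x \<otimes>\<^bsub>L\<^esub> y) \<otimes>\<^bsub>L\<^esub> z"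
    if z: "z \<in> carrier L" for z
  proof -
    note c = assms z bracket_closed
    \<comment> \<open>Anticommutativity brings the cyclic terms of \<open>jacobi\<close> into the
      shape of the goal; uniqueness of negatives then moves \<open>[[x, y], z]\<close> to the other
      side.\<close>
    have "y \<otimes>\<^bsub>L\<^esub> (z \<otimes>\<^bsub>L\<^esub> x) = \<ominus>\<^bsub>L\<^esub> (y \<otimes>\<^bsub>L\<^esub> (x \<otimes>\<^bsub>L\<^esub> z))"
      using c anticommute[of z x] by (simp add: bracket_minus_right)
    moreover have "z \<otimes>\<^bsub>L\<^esub> (x \<otimes>\<^bsub>L\<^esub> y) = \<ominus>\<^bsub>L\<^esub> ((x \<otimes>\<^bsub>L\<^esub> y) \<otimes>\<^bsub>L\<^esub> z)"
      using c anticommute[of z "x \<otimes>\<^bsub>L\<^esub> y"] by simp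
    ultimately show ?thesis
      using jacobi[OF assms z] c M.minus_equality[of "x \<otimes>\<^bsub>L\<^esub> (y \<otimes>\<^bsub>L\<^esub> z) \<ominus>\<^bsub>L\<^esub> y \<otimes>\<^bsub>L\<^esub> (x \<otimes>\<^bsub>L\<^esub> z)"
          "\<ominus>\<^bsub>L\<^esub> ((x \<otimes>\<^bsub>L\<^esub> y) \<otimes>\<^bsub>L\<^esub> z)"]
      by (simp add: M.minus_eq)
  qed
  then show ?thesis
    using assms by (auto simp: gl_def ad_def bracket_closed)
qed

lemma ad_lie_subalgebra: "lie_subalgebra (ad L ` carrier L) K (gl K L)"
proof -
  interpret gl: module K "gl K L" by (rule gl_module)
  have add: "ad L x \<oplus>\<^bsub>gl K L\<^esub> ad L y = ad L (x \<oplus>\<^bsub>L\<^esub> y)" if "x \<in> carrier L" "y \<in> carrier L" for x y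
    using that by (auto simp: gl_def ad_def bracket_add_left)
  have smult: "c \<odot>\<^bsub>gl K L\<^esub> ad L x = ad L (c \<odot>\<^bsub>L\<^esub> x)" if "c \<in> carrier K" "x \<in> carrier L" for c x
    using that by (auto simp: gl_def ad_def bracket_smult_left)
  have zero: "\<zero>\<^bsub>gl K L\<^esub> = ad L \<zero>\<^bsub>L\<^esub>"
    by (auto simp: gl_def ad_def bracket_zero_left)
  have carr: "ad L x \<in> carrier (gl K L)" if "x \<in> carrier L" for x
    using ad_linear[OF that] by (simp add: gl_def)
  \<comment> \<open>Negation in \<open>gl K L\<close> comes only from its additive group, so it is
    identified by uniqueness of inverses.\<close>
  have minus: "\<ominus>\<^bsub>gl K L\<^esub> ad L x = ad L (\<ominus>\<^bsub>L\<^esub> x)" if "x \<in> carrier L" for x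
    using that by (intro gl.minus_equality) (simp_all add: add zero carr M.l_neg)
  have "submodule (ad L ` carrier L) K (gl K L)"
    by (rule gl.submoduleI) (auto simp: add smult zero carr minus)
  then show ?thesis
    by (auto simp: lie_subalgebra_def ad_bracket bracket_closed)
qed

end

section \<open>The Leibniz kernel and its Lie quotient\<close>

context leibniz_algebra
begin

lemma kernel_submodule: "submodule (leibniz_kernel K L) K L"
proof (rule submoduleI)
  \<comment> \<open>The carrier is itself one of the submodules being intersected, as it contains
    all squares.\<close>
  show "leibniz_kernel K L \<subseteq> carrier L"
    using carrier_is_submodule
    by (auto simp: leibniz_kernel_def submodule_span_def bracket_closed)
  show "\<zero>\<^bsub>L\<^esub> \<in> leibniz_kernel K L"
    using subgroup.one_closed[OF submodule.axioms(1)]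
    by (fastforce simp: leibniz_kernel_def submodule_span_def)
qed (simp_all add: leibniz_kernel_def submodule_span_def submoduleE)

lemma square_in_kernel: "x \<in> carrier L \<Longrightarrow> x \<otimes>\<^bsub>L\<^esub> x \<in> leibniz_kernel K L"
  by (auto simp: leibniz_kernel_def submodule_span_def)

text \<open>Serves as induction over the span: a property of kernel elements follows once it defines
  a submodule containing the squares.\<close>

lemma kernel_least:
  assumes "submodule W K L" "\<And>x. x \<in> carrier L \<Longrightarrow> x \<otimes>\<^bsub>L\<^esub> x \<in> W"
  shows "leibniz_kernel K L \<subseteq> W"
  using assms by (auto simp: leibniz_kernel_def submodule_span_def)

text \<open>With two equal arguments, the terms on the right of \<open>right_leibniz\<close>
  cancel.\<close>

lemma bracket_square: "\<lbrakk>x \<in> carrier L; y \<in> carrier L\<rbrakk> \<Longrightarrow> y \<otimes>\<^bsub>L\<^esub> (x \<otimes>\<^bsub>L\<^esub> x) = \<zero>\<^bsub>L\<^esub>"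
  by (simp add: right_leibniz bracket_closed M.minus_eq M.r_neg)

text \<open>The elements \<open>a\<close> with \<open>[L, a] = 0\<close> form a submodule, and it
  contains the squares by \<open>bracket_square\<close>.\<close>

lemma bracket_kernel:
  assumes "a \<in> leibniz_kernel K L" "y \<in> carrier L"
  shows "y \<otimes>\<^bsub>L\<^esub> a = \<zero>\<^bsub>L\<^esub>"
proof -
  have "leibniz_kernel K L \<subseteq> {a \<in> carrier L. \<forall>y\<in>carrier L. y \<otimes>\<^bsub>L\<^esub> a = \<zero>\<^bsub>L\<^esub>}"
    by (intro kernel_least submoduleI)
      (auto simp: bracket_closed bracket_square bracket_zero_right bracket_minus_right
        bracket_add_right bracket_smult_right)
  then show ?thesis using assms by auto
qed

text \<open>Since \<open>[L, I] = 0\<close>, expanding \<open>(x\<^sup>2 + y)\<^sup>2\<close> gives \<open>[x\<^sup>2, y] + y\<^sup>2\<close>.\<close>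

lemma kernel_bracket:
  assumes "a \<in> leibniz_kernel K L" "y \<in> carrier L"
  shows "a \<otimes>\<^bsub>L\<^esub> y \<in> leibniz_kernel K L"
proof -
  note I = submoduleE[OF kernel_submodule] subgroup.one_closed[OF submodule.axioms(1)[OF kernel_submodule]]
  have sq: "(x \<otimes>\<^bsub>L\<^esub> x) \<otimes>\<^bsub>L\<^esub> y \<in> leibniz_kernel K L" if x: "x \<in> carrier L" and y: "y \<in> carrier L" for x y
  proof -
    let ?q = "x \<otimes>\<^bsub>L\<^esub> x"
    have "?q \<otimes>\<^bsub>L\<^esub> y = (?q \<oplus>\<^bsub>L\<^esub> y) \<otimes>\<^bsub>L\<^esub> (?q \<oplus>\<^bsub>L\<^esub> y) \<oplus>\<^bsub>L\<^esub> \<ominus>\<^bsub>L\<^esub> (y \<otimes>\<^bsub>L\<^esub> y)"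
      using x y by (simp add: bracket_add_left bracket_add_right bracket_closed bracket_square
          M.a_assoc M.r_neg)
    also have "\<dots> \<in> leibniz_kernel K L"
      using x y by (intro I square_in_kernel) (simp_all add: bracket_closed)
    finally show ?thesis .
  qed
  \<comment> \<open>The case of squares extends to the span, because bracketing on the right by a
    fixed \<open>y\<close> is linear.\<close>
  have "leibniz_kernel K L \<subseteq> {a \<in> carrier L. \<forall>y\<in>carrier L. a \<otimes>\<^bsub>L\<^esub> y \<in> leibniz_kernel K L}"
    using I by (intro kernel_least submoduleI)
      (auto simp: bracket_closed sq bracket_zero_left bracket_minus_left
        bracket_add_left bracket_smult_left)
  then show ?thesis using assms by auto
qed

sublocale kernel: nonassoc_ideal K L "leibniz_kernel K L"
proof (intro nonassoc_ideal.intro nonassoc_ideal_axioms.intro nonassoc_algebra_axioms kernel_submodule)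
  show "x \<otimes>\<^bsub>L\<^esub> a \<in> leibniz_kernel K L" if "x \<in> carrier L" "a \<in> leibniz_kernel K L" for x a
    using bracket_kernel[OF that(2,1)] subgroup.one_closed[OF submodule.axioms(1)[OF kernel_submodule]]
    by simp
qed (rule kernel_bracket)

text \<open>The Leibniz identity passes to cosets, and squares vanish there because they lie in the
  kernel; \<open>alternating_imp_lie\<close> then applies.\<close>

lemma quotient_lie: "lie_algebra K kernel.Q"
proof -
  interpret Q: nonassoc_algebra K kernel.Q by (rule kernel.quotient_algebra_is_algebra)
  \<comment> \<open>The Leibniz identity contains a subtraction; \<open>h.map_minus\<close> carries
    it to cosets.\<close>
  interpret h: module_epi K L kernel.Q "(+>\<^bsub>L\<^esub>) (leibniz_kernel K L)"
    by (rule kernel.coset_module_epi)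
  have "leibniz_algebra K kernel.Q"
  proof (intro leibniz_algebra.intro leibniz_algebra_axioms.intro Q.nonassoc_algebra_axioms)
    fix X Y Z assume "X \<in> carrier kernel.Q" "Y \<in> carrier kernel.Q" "Z \<in> carrier kernel.Q"
    then obtain x y z where xyz: "x \<in> carrier L" "y \<in> carrier L" "z \<in> carrier L"
      "X = leibniz_kernel K L +>\<^bsub>L\<^esub> x" "Y = leibniz_kernel K L +>\<^bsub>L\<^esub> y" "Z = leibniz_kernel K L +>\<^bsub>L\<^esub> z"
      by (auto simp: kernel.quotient_carrier)
    then show "X \<otimes>\<^bsub>kernel.Q\<^esub> (Y \<otimes>\<^bsub>kernel.Q\<^esub> Z) =
        (X \<otimes>\<^bsub>kernel.Q\<^esub> Y) \<otimes>\<^bsub>kernel.Q\<^esub> Z \<ominus>\<^bsub>kernel.Q\<^esub> (X \<otimes>\<^bsub>kernel.Q\<^esub> Z) \<otimes>\<^bsub>kernel.Q\<^esub> Y"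
      by (simp add: kernel.quotient_mult bracket_closed right_leibniz a_minus_def h.map_add h.map_minus)
  qed
  then interpret Q: leibniz_algebra K kernel.Q .
  show ?thesis
    by (rule Q.alternating_imp_lie)
      (auto simp: kernel.quotient_carrier kernel.quotient_mult kernel.quotient_zero
        square_in_kernel kernel.a_rcos_const)
qed

end

section \<open>Descent of the splitting from the Leibniz algebra to its Lie quotient\<close>

theorem proposition3p8:
  fixes K :: "('k, 'm) ring_scheme" and L :: "('k, 'a, 'n) module_scheme"
  assumes "leibniz_algebra K L"
    and "char_zero K"
    and "\<And>x. x \<in> carrier L \<Longrightarrow> L_split K L x"
  shows "almost_algebraic_leibniz K L"
proof -
  interpret leibniz_algebra K L by fact
  interpret Q: lie_algebra K kernel.Q by (rule quotient_lie)
  let ?h = "(+>\<^bsub>L\<^esub>) (leibniz_kernel K L)"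
  interpret h: module_epi K L kernel.Q ?h by (rule kernel.coset_module_epi)
  \<comment> \<open>These are the linearity and intertwining premises of
    \<open>jordan_decomposition_image\<close>, for right multiplications and the coset map.\<close>
  have R: "right_mult kernel.Q (?h x) \<in> linear_endos K kernel.Q"
    "right_mult kernel.Q (?h x) (?h y) = ?h (right_mult L x y)"
    if "x \<in> carrier L" "y \<in> carrier L" for x y
    using Q.right_mult_linear[OF h.map_closed[OF that(1)]] h.map_closed[of y] that
    by (simp_all add: right_mult_def kernel.quotient_mult)
  \<comment> \<open>The Jordan components will arise as right multiplications; right multiplication
    by a coset is \<open>ad\<close> of its negative.\<close>
  have ad_image: "right_mult kernel.Q (?h x) \<in> ad kernel.Q ` carrier kernel.Q" if "x \<in> carrier L" for x
    using that Q.ad_conv_right_mult[of "\<ominus>\<^bsub>kernel.Q\<^esub> ?h x"]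
    by (intro image_eqI[of _ _ "\<ominus>\<^bsub>kernel.Q\<^esub> ?h x"]) simp_all
  have "\<exists>S\<in>ad kernel.Q ` carrier kernel.Q. \<exists>N\<in>ad kernel.Q ` carrier kernel.Q.
      jordan_decomposition K kernel.Q (ad kernel.Q X) S N" if "X \<in> carrier kernel.Q" for X
  proof -
    from that obtain x where x: "x \<in> carrier L" "X = ?h x" by (rule h.carrier_cases)
    \<comment> \<open>The splitting is taken at the negative of \<open>x\<close> because
      \<open>ad\<close> of the coset of \<open>x\<close> is right multiplication by the coset of
      that negative.\<close>
    have mx: "\<ominus>\<^bsub>L\<^esub> x \<in> carrier L" using x by simp
    from assms(3)[OF mx] obtain s n where sn: "s \<in> carrier L" "n \<in> carrier L"
      "jordan_decomposition K L (right_mult L (\<ominus>\<^bsub>L\<^esub> x)) (right_mult L s) (right_mult L n)"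
      by (auto simp: L_split_def)
    have "jordan_decomposition K kernel.Q (right_mult kernel.Q (?h (\<ominus>\<^bsub>L\<^esub> x)))
        (right_mult kernel.Q (?h s)) (right_mult kernel.Q (?h n))"
      by (rule h.jordan_decomposition_image[OF sn(3)]) (use R mx sn(1,2) in blast)+
    then have "jordan_decomposition K kernel.Q (ad kernel.Q X)
        (right_mult kernel.Q (?h s)) (right_mult kernel.Q (?h n))"
      using x by (simp add: Q.ad_conv_right_mult h.map_minus)
    then show ?thesis using ad_image sn(1,2) by blast
  qed
  then show ?thesis
    using assms(1) Q.ad_lie_subalgebra Q.lie_algebra_axioms
    by (auto simp: almost_algebraic_leibniz_def almost_algebraic_lie_def almost_algebraic_linear_def)
qed

end
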